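(* Let $(Y,\mathbf{X})$ be a $(d+1)$-dimensional random vector such that the distribution function $F_Y$ of $Y$ is continuous. The following statements are equivalent: (i) $\phi_{(Y,\mathbf{X})}(0)=1$. (ii) There exists a measurable function $f:\mathbb{R}^d\to\mathbb{R}$ such that $Y=f(\mathbf{X})$ almost surely.
   Context: $Y$ is real-valued and $\mathbf{X}$ takes values in $\mathbb{R}^d$, $d\ge 1$. $Y'$ is a random variable (on a possibly extended probability space) such that, conditionally on $\mathbf{X}$, $Y$ and $Y'$ are independent and identically distributed, i.e. $\mathbb{P}(Y\in A, Y'\in B\mid \mathbf{X})=\mathbb{P}(Y\in A\mid\mathbf{X})\,\mathbb{P}(Y\in B\mid\mathbf{X})$ almost surely for all Borel sets $A,B\subseteq\mathbb{R}$. For $t\in[0,1]$, $$\phi_{(Y,\mathbf{X})}(t):=\mathbb{P}\bigl(|F_Y(Y)-F_Y(Y')|\le t\bigr).$$ *)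

theory Defs
  imports "HOL-Probability.Probability"
begin

text \<open>The distribution function of a real random variable.\<close>
definition distribution_function :: "'a measure \<Rightarrow> ('a \<Rightarrow> real) \<Rightarrow> real \<Rightarrow> real" where
  "distribution_function M Y = cdf (distr M borel Y)"

text \<open>\<^term>\<open>p\<close> exhibits \<^term>\<open>N\<close> as an extension of the probability space \<^term>\<open>M\<close>; a random
  variable \<^term>\<open>Z\<close> on \<^term>\<open>M\<close> is identified with \<^term>\<open>Z \<circ> p\<close> on \<^term>\<open>N\<close>. The case
  \<^term>\<open>N = M\<close> with the identity map is the trivial extension.\<close>
definition prob_space_extension :: "'a measure \<Rightarrow> 'b measure \<Rightarrow> ('b \<Rightarrow> 'a) \<Rightarrow> bool" where
  "prob_space_extension M N p \<longleftrightarrow>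
     prob_space M \<and> prob_space N \<and> p \<in> measurable N M \<and> distr N M p = M"

text \<open>A version of the conditional probability of the event \<^term>\<open>A\<close> given the sigma-algebra
  generated by \<^term>\<open>X\<close>.\<close>
definition cond_prob_given ::
  "'a measure \<Rightarrow> ('a \<Rightarrow> 'x::topological_space) \<Rightarrow> 'a set \<Rightarrow> 'a \<Rightarrow> real" where
  "cond_prob_given M X A =
     real_cond_exp M (vimage_algebra (space M) X borel) (indicator A)"

text \<open>On the right-hand side both factors involve \<^term>\<open>Y\<close>, so the identity encodes conditional
  independence and, with \<^term>\<open>A = (UNIV :: real set)\<close>, equality of the conditional laws.\<close>
definition cond_iid_given ::
  "'a measure \<Rightarrow> ('a \<Rightarrow> 'x::topological_space) \<Rightarrow> ('a \<Rightarrow> real) \<Rightarrow> ('a \<Rightarrow> real) \<Rightarrow> bool" where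
  "cond_iid_given M X Y Y' \<longleftrightarrow>
     (\<forall>A \<in> sets borel. \<forall>B \<in> sets borel. AE \<omega> in M.
        cond_prob_given M X {\<omega> \<in> space M. Y \<omega> \<in> A \<and> Y' \<omega> \<in> B} \<omega> =
        cond_prob_given M X {\<omega> \<in> space M. Y \<omega> \<in> A} \<omega> *
        cond_prob_given M X {\<omega> \<in> space M. Y \<omega> \<in> B} \<omega>)"

text \<open>The dependence on the conditioning vector enters only through the copy \<^term>\<open>Y'\<close>.\<close>
definition phi :: "'a measure \<Rightarrow> ('a \<Rightarrow> real) \<Rightarrow> ('a \<Rightarrow> real) \<Rightarrow> real \<Rightarrow> real" where
  "phi M Y Y' t =
     measure M {\<omega> \<in> space M.
       \<bar>distribution_function M Y (Y \<omega>) - distribution_function M Y (Y' \<omega>)\<bar> \<le> t}"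

end

theory Submission
  imports Defs
begin

text \<open>
  The distribution function \<open>F\<close> of \<open>Y\<close> can only identify points that lie on a common flat piece of
  \<open>F\<close>, and such pieces carry no mass. Since \<open>Y'\<close> has the same law as \<open>Y\<close>, it follows that
  \<open>F(Y) = F(Y')\<close> almost surely if and only if \<open>Y = Y'\<close> almost surely
  (\<open>AE_cdf_eq_iff\<close>). The value of \<open>phi\<close> at \<open>0\<close> is therefore \<open>1\<close> exactly when \<open>Y = Y'\<close> almost surely,
  and it remains to compare this with \<open>Y\<close> being a function of \<open>X\<close>
  (\<open>AE_eq_cond_iid_copy_iff\<close>).

  Both properties can be read off the conditional probabilities \<open>g = P(Y \<le> r | X)\<close>. Conditional
  independence turns \<open>Y = Y'\<close> into \<open>g = g\<^sup>2\<close>, so \<open>g\<close> is an indicator function, which forces the event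
  \<open>Y \<le> r\<close> to coincide, up to a null set, with an event \<open>X \<in> B\<^sub>r\<close>. Knowing \<open>B\<^sub>r\<close> for all rational
  \<open>r\<close>, one recovers \<open>Y\<close> as the infimum of those \<open>r\<close> with \<open>X \<in> B\<^sub>r\<close>. Conversely, if \<open>Y\<close> is a function
  of \<open>X\<close>, then \<open>g\<close> is an indicator function, so that
  \<open>P(Y \<le> r < Y' | X) = g (1 - g) = 0\<close> for every rational \<open>r\<close>, and likewise with \<open>Y\<close> and \<open>Y'\<close>
  exchanged. Hence no rational separates \<open>Y\<close> from \<open>Y'\<close>.
\<close>

section \<open>Flat pieces of a distribution function\<close>

text \<open>
  The points above \<open>r\<close> with the same value of the distribution function form an interval with left
  end point \<open>r\<close>. It is a countable union of null intervals \<open>{r<..t}\<close>: rational \<open>t\<close> suffice, except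
  that the interval may contain its right end point.
\<close>
lemma (in real_distribution) AE_cdf_increases:
  "AE z in M. r < z \<longrightarrow> cdf M r < cdf M z"
proof -
  define J where "J = {z. r < z \<and> cdf M z \<le> cdf M r}"
  have null: "{r<..t} \<in> null_sets M" if "t \<in> J" for t
  proof -
    have "measure M {r<..t} = cdf M t - cdf M r"
      using that cdf_diff_eq[of r t] by (simp add: J_def)
    also have "\<dots> \<le> 0"
      using that by (simp add: J_def)
    finally show ?thesis
      by (intro null_setsI) (auto simp: emeasure_eq_measure measure_le_0_iff)
  qed
  have "\<exists>S\<in>null_sets M. J \<subseteq> S"
  proof (cases "\<exists>m\<in>J. \<forall>z\<in>J. z \<le> m")
    case True
    then obtain m where m: "m \<in> J" "\<forall>z\<in>J. z \<le> m" by blast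
    then show ?thesis
      by (intro bexI[OF _ null[OF m(1)]]) (auto simp: J_def)
  next
    case False
    let ?S = "\<Union>q\<in>\<rat> \<inter> J. {r<..q}"
    have "J \<subseteq> ?S"
    proof
      fix z assume z: "z \<in> J"
      then obtain t where t: "t \<in> J" "z < t"
        using False by force
      then obtain q where q: "q \<in> \<rat>" "z < q" "q < t"
        using Rats_dense_in_real by blast
      have "cdf M q \<le> cdf M t"
        using q by (intro cdf_nondecreasing) simp
      then have "q \<in> \<rat> \<inter> J"
        using q z t by (simp add: J_def)
      moreover have "z \<in> {r<..q}"
        using q z by (simp add: J_def)
      ultimately show "z \<in> ?S" by blast
    qed
    moreover have "?S \<in> null_sets M"
      using null countable_rat by (intro null_sets_UN') auto
    ultimately show ?thesis by blast
  qed
  then obtain S where "S \<in> null_sets M" "J \<subseteq> S" by blast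
  then show ?thesis
    by (intro AE_I'[of S]) (auto simp: J_def not_less)
qed

text \<open>Two distinct reals are separated by a rational, so only countably many null events matter.\<close>
lemma AE_eq_if_rational_cuts:
  fixes U V :: "'a \<Rightarrow> real"
  assumes "\<And>r. r \<in> \<rat> \<Longrightarrow> AE \<omega> in M. \<not> (U \<omega> \<le> r \<and> r < V \<omega>)"
    and "\<And>r. r \<in> \<rat> \<Longrightarrow> AE \<omega> in M. \<not> (V \<omega> \<le> r \<and> r < U \<omega>)"
  shows "AE \<omega> in M. U \<omega> = V \<omega>"
proof -
  have "AE \<omega> in M. \<forall>r\<in>\<rat>. \<not> (U \<omega> \<le> r \<and> r < V \<omega>)"
    using assms(1) by (simp add: AE_ball_countable countable_rat)
  moreover have "AE \<omega> in M. \<forall>r\<in>\<rat>. \<not> (V \<omega> \<le> r \<and> r < U \<omega>)"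
    using assms(2) by (simp add: AE_ball_countable countable_rat)
  ultimately show ?thesis
  proof eventually_elim
    case (elim \<omega>)
    show ?case
    proof (rule linorder_cases[of "U \<omega>" "V \<omega>"])
      assume "U \<omega> < V \<omega>"
      with Rats_dense_in_real[of "U \<omega>" "V \<omega>"] elim show ?thesis
        by (meson less_imp_le)
    next
      assume "V \<omega> < U \<omega>"
      with Rats_dense_in_real[of "V \<omega>" "U \<omega>"] elim show ?thesis
        by (meson less_imp_le)
    qed
  qed
qed

text \<open>
  If \<open>Z \<le> r < Z'\<close>, equality of the two values of the distribution function places \<open>Z'\<close> on the flat
  piece that starts at \<open>r\<close>; the common law makes the null set of \<open>AE_cdf_increases\<close> available for
  both variables.
\<close>
lemma (in prob_space) AE_cdf_eq_iff:
  fixes Z Z' :: "'a \<Rightarrow> real"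
  assumes Z [measurable]: "Z \<in> borel_measurable M" and Z' [measurable]: "Z' \<in> borel_measurable M"
    and same_law: "distr M borel Z' = distr M borel Z"
  shows "(AE \<omega> in M. cdf (distr M borel Z) (Z \<omega>) = cdf (distr M borel Z) (Z' \<omega>)) \<longleftrightarrow>
    (AE \<omega> in M. Z \<omega> = Z' \<omega>)"
proof
  let ?D = "distr M borel Z"
  interpret D: real_distribution ?D by simp
  assume eq: "AE \<omega> in M. cdf ?D (Z \<omega>) = cdf ?D (Z' \<omega>)"
  have incr: "AE \<omega> in M. r < Z \<omega> \<longrightarrow> cdf ?D r < cdf ?D (Z \<omega>)"
    and incr': "AE \<omega> in M. r < Z' \<omega> \<longrightarrow> cdf ?D r < cdf ?D (Z' \<omega>)" for r
  proof -
    show "AE \<omega> in M. r < Z \<omega> \<longrightarrow> cdf ?D r < cdf ?D (Z \<omega>)"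
      using AE_distrD[OF Z D.AE_cdf_increases[of r]] .
    have "AE z in distr M borel Z'. r < z \<longrightarrow> cdf ?D r < cdf ?D z"
      unfolding same_law by (rule D.AE_cdf_increases)
    from AE_distrD[OF Z' this]
    show "AE \<omega> in M. r < Z' \<omega> \<longrightarrow> cdf ?D r < cdf ?D (Z' \<omega>)" .
  qed
  show "AE \<omega> in M. Z \<omega> = Z' \<omega>"
  proof (rule AE_eq_if_rational_cuts)
    fix r
    show "AE \<omega> in M. \<not> (Z \<omega> \<le> r \<and> r < Z' \<omega>)"
      using eq incr'[of r] by eventually_elim (metis D.cdf_nondecreasing not_less)
    show "AE \<omega> in M. \<not> (Z' \<omega> \<le> r \<and> r < Z \<omega>)"
      using eq incr[of r] by eventually_elim (metis D.cdf_nondecreasing not_less)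
  qed
qed (auto elim: eventually_mono)

lemma (in prob_space) phi_0_eq_1_iff:
  assumes [measurable]: "Z \<in> borel_measurable M" "Z' \<in> borel_measurable M"
    and "distr M borel Z' = distr M borel Z"
  shows "phi M Z Z' 0 = 1 \<longleftrightarrow> (AE \<omega> in M. Z \<omega> = Z' \<omega>)"
proof -
  interpret D: real_distribution "distr M borel Z" by simp
  have [measurable]: "cdf (distr M borel Z) \<in> borel_measurable borel"
    by (intro borel_measurable_mono monoI D.cdf_nondecreasing)
  have "phi M Z Z' 0 = 1 \<longleftrightarrow>
    (AE \<omega> in M. \<bar>cdf (distr M borel Z) (Z \<omega>) - cdf (distr M borel Z) (Z' \<omega>)\<bar> \<le> 0)"
    unfolding phi_def distribution_function_def by (rule prob_Collect_eq_1) measurable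
  then show ?thesis
    using AE_cdf_eq_iff[OF assms] by simp
qed

section \<open>Events determined by a random variable\<close>

text \<open>
  Membership of \<open>A\<close> in the completion of the sigma-algebra generated by \<open>W\<close>. Naming the Borel set
  is what later allows functions of the value of \<open>W\<close> to be assembled.
\<close>
definition determined_by :: "'a measure \<Rightarrow> ('a \<Rightarrow> 'x::topological_space) \<Rightarrow> 'a set \<Rightarrow> bool" where
  "determined_by M W A \<longleftrightarrow> (\<exists>B\<in>sets borel. AE \<omega> in M. \<omega> \<in> A \<longleftrightarrow> W \<omega> \<in> B)"

lemma (in prob_space) finite_measure_subalgebra_vimage:
  fixes W :: "'a \<Rightarrow> 'x::topological_space"
  assumes "W \<in> borel_measurable M"
  shows "finite_measure_subalgebra M (vimage_algebra (space M) W borel)"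
proof
  show "subalgebra M (vimage_algebra (space M) W borel)"
    unfolding subalgebra_def using assms
    by (auto simp: sets_vimage_algebra2 intro: measurable_sets)
qed

lemma (in prob_space) integrable_indicator_event:
  assumes "A \<in> events"
  shows "integrable M (indicator A :: 'a \<Rightarrow> real)"
  using assms by (intro integrable_real_indicator) (auto simp: less_top[symmetric])

lemma (in prob_space) integral_cond_prob_given:
  fixes W :: "'a \<Rightarrow> 'x::topological_space"
  assumes "W \<in> borel_measurable M" and [measurable]: "A \<in> events"
  shows "(\<integral>\<omega>. cond_prob_given M W A \<omega> \<partial>M) = prob A"
proof -
  interpret finite_measure_subalgebra M "vimage_algebra (space M) W borel"
    by (rule finite_measure_subalgebra_vimage[OF assms(1)])
  show ?thesis
    unfolding cond_prob_given_def by (subst real_cond_exp_int(2)) (auto intro: integrable_indicator_event)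
qed

lemma (in prob_space) cond_prob_given_space:
  fixes W :: "'a \<Rightarrow> 'x::topological_space"
  assumes "W \<in> borel_measurable M"
  shows "AE \<omega> in M. cond_prob_given M W (space M) \<omega> = 1"
proof -
  let ?F = "vimage_algebra (space M) W borel"
  interpret finite_measure_subalgebra M ?F
    by (rule finite_measure_subalgebra_vimage[OF assms])
  have "indicator (space M) \<in> borel_measurable ?F"
    using sets.top[of ?F] by (intro borel_measurable_indicator) simp
  then have "AE \<omega> in M. cond_prob_given M W (space M) \<omega> = indicator (space M) \<omega>"
    unfolding cond_prob_given_def by (intro real_cond_exp_F_meas integrable_indicator_event) simp_all
  then show ?thesis
    using AE_space by eventually_elim simp
qed

text \<open>The tower property on an event \<open>W \<in> B\<close>.\<close>
lemma (in prob_space) set_integral_cond_prob_given: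
  fixes W :: "'a \<Rightarrow> 'x::topological_space"
  assumes W: "W \<in> borel_measurable M" and A [measurable]: "A \<in> events" and B: "B \<in> sets borel"
  shows "(\<integral>\<omega>\<in>W -` B \<inter> space M. cond_prob_given M W A \<omega> \<partial>M) = prob (A \<inter> (W -` B \<inter> space M))"
proof -
  let ?S = "W -` B \<inter> space M"
  interpret finite_measure_subalgebra M "vimage_algebra (space M) W borel"
    by (rule finite_measure_subalgebra_vimage[OF W])
  have [measurable]: "?S \<in> events"
    using W B by (rule measurable_sets)
  have "(\<integral>\<omega>\<in>?S. cond_prob_given M W A \<omega> \<partial>M) = (\<integral>\<omega>\<in>?S. indicator A \<omega> \<partial>M)"
    unfolding cond_prob_given_def using B
    by (intro real_cond_exp_intA[symmetric] in_vimage_algebra integrable_indicator_event) auto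
  also have "\<dots> = (\<integral>\<omega>. indicator (A \<inter> ?S) \<omega> \<partial>M)"
    unfolding set_lebesgue_integral_def
    by (intro Bochner_Integration.integral_cong) (auto simp: indicator_def)
  also have "\<dots> = prob (A \<inter> ?S)" by simp
  finally show ?thesis .
qed

lemma (in prob_space) cond_prob_given_determined:
  fixes W :: "'a \<Rightarrow> 'x::topological_space"
  assumes W: "W \<in> borel_measurable M" and A [measurable]: "A \<in> events" and B: "B \<in> sets borel"
    and det: "AE \<omega> in M. \<omega> \<in> A \<longleftrightarrow> W \<omega> \<in> B"
  shows "AE \<omega> in M. cond_prob_given M W A \<omega> = indicator B (W \<omega>)"
proof -
  let ?F = "vimage_algebra (space M) W borel" and ?S = "W -` B \<inter> space M"
  interpret finite_measure_subalgebra M ?F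
    by (rule finite_measure_subalgebra_vimage[OF W])
  have S: "?S \<in> sets ?F"
    using B by (rule in_vimage_algebra)
  have [measurable]: "?S \<in> events"
    using W B by (rule measurable_sets)
  have "AE \<omega> in M. (indicator A \<omega> :: real) = indicator ?S \<omega>"
    using det AE_space by eventually_elim (auto simp: indicator_def)
  then have "AE \<omega> in M. cond_prob_given M W A \<omega> = real_cond_exp M ?F (indicator ?S) \<omega>"
    unfolding cond_prob_given_def by (intro real_cond_exp_cong) auto
  moreover have "AE \<omega> in M. real_cond_exp M ?F (indicator ?S) \<omega> = indicator ?S \<omega>"
    using S by (intro real_cond_exp_F_meas borel_measurable_indicator integrable_indicator_event) auto
  ultimately show ?thesis
    using AE_space by eventually_elim (auto simp: indicator_def)
qed

text \<open>
  An idempotent conditional probability is an indicator, say of \<open>W \<in> B\<close>. Integrating it over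
  \<open>W \<in> B\<close> and over the complement shows that \<open>A\<close> fills the former and misses the latter.
\<close>
lemma (in prob_space) determined_by_if_cond_prob_idempotent:
  fixes W :: "'a \<Rightarrow> 'x::topological_space"
  assumes W: "W \<in> borel_measurable M" and A [measurable]: "A \<in> events"
    and idem: "AE \<omega> in M. cond_prob_given M W A \<omega> = cond_prob_given M W A \<omega> * cond_prob_given M W A \<omega>"
  shows "determined_by M W A"
proof -
  let ?F = "vimage_algebra (space M) W borel" and ?g = "cond_prob_given M W A"
  have g: "?g \<in> borel_measurable ?F"
    unfolding cond_prob_given_def by (rule borel_measurable_cond_exp)
  have "?g -` {1} \<inter> space ?F \<in> sets ?F"
    using g by (rule measurable_sets) simp
  then obtain B where B: "B \<in> sets borel" and gB: "?g -` {1} \<inter> space M = W -` B \<inter> space M"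
    by (auto simp: sets_vimage_algebra2)
  let ?S = "W -` B \<inter> space M" and ?T = "W -` (- B) \<inter> space M"
  have B': "- B \<in> sets borel" using B by (simp add: borel_comp)
  have [measurable]: "?S \<in> events" "?T \<in> events"
    using W B B' by (auto intro: measurable_sets)
  interpret finite_measure_subalgebra M ?F
    by (rule finite_measure_subalgebra_vimage[OF W])
  have g_meas [measurable]: "?g \<in> borel_measurable M"
    unfolding cond_prob_given_def by (rule borel_measurable_cond_exp2)
  have g01: "AE \<omega> in M. ?g \<omega> = indicator ?S \<omega>"
    using idem AE_space
  proof eventually_elim
    case (elim \<omega>)
    have "\<omega> \<in> ?S \<longleftrightarrow> ?g \<omega> = 1"
      using gB elim(2) by blast
    moreover have "?g \<omega> = 0 \<or> ?g \<omega> = 1"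
      using elim(1) by (metis mult_cancel_right1)
    ultimately show ?case by (auto simp: indicator_def)
  qed
  have "prob (A \<inter> ?S) = (\<integral>\<omega>\<in>?S. ?g \<omega> \<partial>M)"
    using set_integral_cond_prob_given[OF W A B] by simp
  also have "\<dots> = (\<integral>\<omega>. indicator ?S \<omega> \<partial>M)"
  proof -
    have "AE \<omega> in M. indicator ?S \<omega> *\<^sub>R ?g \<omega> = indicator ?S \<omega>"
      using g01 by eventually_elim (auto simp: indicator_def)
    then show ?thesis
      unfolding set_lebesgue_integral_def by (rule integral_cong_AE[rotated 2]) measurable
  qed
  finally have full: "prob (A \<inter> ?S) = prob ?S" by simp
  have "prob (A \<inter> ?T) = (\<integral>\<omega>\<in>?T. ?g \<omega> \<partial>M)"
    using set_integral_cond_prob_given[OF W A B'] by simp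
  also have "\<dots> = (\<integral>\<omega>. 0 \<partial>M)"
  proof -
    have "AE \<omega> in M. indicator ?T \<omega> *\<^sub>R ?g \<omega> = 0"
      using g01 by eventually_elim (auto simp: indicator_def)
    then show ?thesis
      unfolding set_lebesgue_integral_def by (rule integral_cong_AE[rotated 2]) measurable
  qed
  finally have none: "prob (A \<inter> ?T) = 0" by simp
  have "prob (?S - A) = prob ?S - prob (A \<inter> ?S)"
    using finite_measure_Diff'[OF \<open>?S \<in> events\<close> A] by (simp add: Int_commute)
  then have "?S - A \<in> null_sets M" "A \<inter> ?T \<in> null_sets M"
    using full none by (auto simp: null_sets_def emeasure_eq_measure)
  then have "AE \<omega> in M. \<omega> \<notin> ?S - A" "AE \<omega> in M. \<omega> \<notin> A \<inter> ?T"
    by (simp_all only: AE_not_in)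
  then have "AE \<omega> in M. \<omega> \<in> A \<longleftrightarrow> W \<omega> \<in> B"
    using AE_space by eventually_elim auto
  then show ?thesis
    unfolding determined_by_def using B by blast
qed

text \<open>
  If the half-line events \<open>Z \<le> r\<close> are the events \<open>W \<in> B\<^sub>r\<close>, then \<open>Z\<close> is the infimum of the rationals
  \<open>r\<close> with \<open>W \<in> B\<^sub>r\<close>. As this infimum may be infinite at values that \<open>W\<close> almost never takes, it is
  formed in the extended reals, where countable infima of measurable functions are measurable.
\<close>
lemma function_of_if_half_lines_determined:
  fixes W :: "'a \<Rightarrow> 'x::topological_space" and Z :: "'a \<Rightarrow> real"
  assumes "\<And>r. r \<in> \<rat> \<Longrightarrow> determined_by M W {\<omega> \<in> space M. Z \<omega> \<le> r}"
  shows "\<exists>f\<in>borel_measurable borel. AE \<omega> in M. Z \<omega> = f (W \<omega>)"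
proof -
  obtain B where B: "\<And>r. r \<in> \<rat> \<Longrightarrow> B r \<in> sets borel"
    and AE_B: "\<And>r. r \<in> \<rat> \<Longrightarrow> AE \<omega> in M. \<omega> \<in> {\<omega> \<in> space M. Z \<omega> \<le> r} \<longleftrightarrow> W \<omega> \<in> B r"
    using assms unfolding determined_by_def by metis
  define h where "h x = (INF r\<in>\<rat>. if x \<in> B r then ereal r else \<infinity>)" for x
  have "h \<in> borel_measurable borel"
    unfolding h_def using B countable_rat by (intro borel_measurable_INF measurable_If_set) auto
  then have meas: "(\<lambda>x. real_of_ereal (h x)) \<in> borel_measurable borel"
    by measurable
  have "AE \<omega> in M. \<forall>r\<in>\<rat>. \<omega> \<in> {\<omega> \<in> space M. Z \<omega> \<le> r} \<longleftrightarrow> W \<omega> \<in> B r"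
    using AE_B by (simp add: AE_ball_countable countable_rat)
  then have "AE \<omega> in M. Z \<omega> = real_of_ereal (h (W \<omega>))"
    using AE_space
  proof eventually_elim
    case (elim \<omega>)
    then have cut: "W \<omega> \<in> B r \<longleftrightarrow> Z \<omega> \<le> r" if "r \<in> \<rat>" for r
      using that by blast
    have "h (W \<omega>) = ereal (Z \<omega>)"
    proof (rule antisym)
      show "ereal (Z \<omega>) \<le> h (W \<omega>)"
        unfolding h_def by (rule INF_greatest) (simp add: cut)
      show "h (W \<omega>) \<le> ereal (Z \<omega>)"
      proof (rule dense_ge)
        fix y assume "ereal (Z \<omega>) < y"
        then obtain s where s: "ereal (Z \<omega>) < ereal s" "ereal s < y"
          using ereal_dense2 by blast
        then obtain r where r: "r \<in> \<rat>" "Z \<omega> < r" "r < s"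
          using Rats_dense_in_real[of "Z \<omega>" s] by auto
        have "h (W \<omega>) \<le> (if W \<omega> \<in> B r then ereal r else \<infinity>)"
          unfolding h_def using r(1) by (rule INF_lower)
        also have "\<dots> = ereal r"
          using r by (simp add: cut)
        also have "\<dots> \<le> ereal s" using r by simp
        also have "\<dots> \<le> y" using s by simp
        finally show "h (W \<omega>) \<le> y" .
      qed
    qed
    then show ?case by simp
  qed
  with meas show ?thesis
    by (intro bexI[of _ "\<lambda>x. real_of_ereal (h x)"])
qed

section \<open>Conditionally independent copies\<close>

lemma (in prob_space) cond_iid_given_same_law:
  fixes W :: "'a \<Rightarrow> 'x::topological_space"
  assumes W: "W \<in> borel_measurable M"
    and Z [measurable]: "Z \<in> borel_measurable M" and Z' [measurable]: "Z' \<in> borel_measurable M"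
    and iid: "cond_iid_given M W Z Z'"
  shows "distr M borel Z' = distr M borel Z"
proof (rule measure_eqI)
  fix B :: "real set" assume "B \<in> sets (distr M borel Z')"
  then have B [measurable]: "B \<in> sets borel" by simp
  let ?C' = "{\<omega> \<in> space M. Z' \<omega> \<in> B}" and ?C = "{\<omega> \<in> space M. Z \<omega> \<in> B}"
  have "AE \<omega> in M. cond_prob_given M W ?C' \<omega> =
      cond_prob_given M W (space M) \<omega> * cond_prob_given M W ?C \<omega>"
    using iid[unfolded cond_iid_given_def, rule_format, of UNIV B] B by simp
  then have eq: "AE \<omega> in M. cond_prob_given M W ?C' \<omega> = cond_prob_given M W ?C \<omega>"
    using cond_prob_given_space[OF W] by eventually_elim simp
  interpret finite_measure_subalgebra M "vimage_algebra (space M) W borel"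
    by (rule finite_measure_subalgebra_vimage[OF W])
  have [measurable]: "cond_prob_given M W C \<in> borel_measurable M" for C
    unfolding cond_prob_given_def by (rule borel_measurable_cond_exp2)
  have "prob ?C' = (\<integral>\<omega>. cond_prob_given M W ?C' \<omega> \<partial>M)"
    using integral_cond_prob_given[OF W, of ?C'] by simp
  also have "\<dots> = (\<integral>\<omega>. cond_prob_given M W ?C \<omega> \<partial>M)"
    using eq by (intro integral_cong_AE) auto
  also have "\<dots> = prob ?C"
    using integral_cond_prob_given[OF W, of ?C] by simp
  finally show "emeasure (distr M borel Z') B = emeasure (distr M borel Z) B"
    by (simp add: emeasure_distr emeasure_eq_measure vimage_def Int_def conj_commute)
qed simp

text \<open>
  For \<open>Z = f(W)\<close> the events \<open>Z \<in> A\<close> and \<open>Z \<notin> A\<close> have as conditional probabilities two indicators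
  with product \<open>0\<close>, and this product is the conditional probability that \<open>Z \<in> A\<close> and \<open>Z' \<notin> A\<close>.
\<close>
lemma (in prob_space) cond_iid_copy_not_separated:
  fixes W :: "'a \<Rightarrow> 'x::topological_space"
  assumes W [measurable]: "W \<in> borel_measurable M"
    and [measurable]: "Z \<in> borel_measurable M" "Z' \<in> borel_measurable M"
    and iid: "cond_iid_given M W Z Z'"
    and f [measurable]: "f \<in> borel_measurable borel" and Zf: "AE \<omega> in M. Z \<omega> = f (W \<omega>)"
    and A [measurable]: "A \<in> sets borel"
  shows "AE \<omega> in M. \<not> (Z \<omega> \<in> A \<and> Z' \<omega> \<in> - A)"
proof -
  let ?E = "{\<omega> \<in> space M. Z \<omega> \<in> A \<and> Z' \<omega> \<in> - A}"
  have A' [measurable]: "- A \<in> sets borel" using A by (simp add: borel_comp)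
  have ind: "AE \<omega> in M. cond_prob_given M W {\<omega> \<in> space M. Z \<omega> \<in> C} \<omega> = indicator C (f (W \<omega>))"
    if C [measurable]: "C \<in> sets borel" for C
  proof -
    have fC: "f -` C \<in> sets borel"
      using measurable_sets[OF f C] by simp
    have "AE \<omega> in M. \<omega> \<in> {\<omega> \<in> space M. Z \<omega> \<in> C} \<longleftrightarrow> W \<omega> \<in> f -` C"
      using Zf AE_space by eventually_elim auto
    then have "AE \<omega> in M. cond_prob_given M W {\<omega> \<in> space M. Z \<omega> \<in> C} \<omega> = indicator (f -` C) (W \<omega>)"
      using fC by (intro cond_prob_given_determined W) auto
    then show ?thesis by (simp add: indicator_def)
  qed
  have "AE \<omega> in M. cond_prob_given M W ?E \<omega> =
      cond_prob_given M W {\<omega> \<in> space M. Z \<omega> \<in> A} \<omega> * cond_prob_given M W {\<omega> \<in> space M. Z \<omega> \<in> - A} \<omega>"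
    using iid[unfolded cond_iid_given_def, rule_format, OF A A'] .
  then have "AE \<omega> in M. cond_prob_given M W ?E \<omega> = 0"
    using ind[OF A] ind[OF A'] by eventually_elim (simp add: indicator_def)
  then have "(\<integral>\<omega>. cond_prob_given M W ?E \<omega> \<partial>M) = 0"
    by (rule integral_eq_zero_AE)
  then have "prob ?E = 0"
    using integral_cond_prob_given[OF W, of ?E] by simp
  then have "AE \<omega> in M. \<omega> \<notin> ?E"
    by (intro AE_not_in) (auto simp: null_sets_def emeasure_eq_measure)
  then show ?thesis
    using AE_space by eventually_elim auto
qed

text \<open>
  A conditionally independent copy reproduces \<open>Z\<close> exactly when no randomness is left in \<open>Z\<close> once
  \<open>W\<close> is known.
\<close>
lemma (in prob_space) AE_eq_cond_iid_copy_iff: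
  fixes W :: "'a \<Rightarrow> 'x::topological_space"
  assumes W: "W \<in> borel_measurable M"
    and Z [measurable]: "Z \<in> borel_measurable M" and Z' [measurable]: "Z' \<in> borel_measurable M"
    and iid: "cond_iid_given M W Z Z'"
  shows "(AE \<omega> in M. Z \<omega> = Z' \<omega>) \<longleftrightarrow>
    (\<exists>f\<in>borel_measurable borel. AE \<omega> in M. Z \<omega> = f (W \<omega>))"
proof
  assume eq: "AE \<omega> in M. Z \<omega> = Z' \<omega>"
  interpret finite_measure_subalgebra M "vimage_algebra (space M) W borel"
    by (rule finite_measure_subalgebra_vimage[OF W])
  show "\<exists>f\<in>borel_measurable borel. AE \<omega> in M. Z \<omega> = f (W \<omega>)"
  proof (rule function_of_if_half_lines_determined)
    fix r :: real
    let ?A = "{\<omega> \<in> space M. Z \<omega> \<le> r}"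
    let ?A2 = "{\<omega> \<in> space M. Z \<omega> \<in> {..r} \<and> Z' \<omega> \<in> {..r}}"
    have "AE \<omega> in M. (indicator ?A \<omega> :: real) = indicator ?A2 \<omega>"
      using eq by eventually_elim (auto simp: indicator_def)
    then have "AE \<omega> in M. cond_prob_given M W ?A \<omega> = cond_prob_given M W ?A2 \<omega>"
      unfolding cond_prob_given_def by (intro real_cond_exp_cong) auto
    moreover have "AE \<omega> in M. cond_prob_given M W ?A2 \<omega> =
        cond_prob_given M W ?A \<omega> * cond_prob_given M W ?A \<omega>"
      using iid[unfolded cond_iid_given_def, rule_format, of "{..r}" "{..r}"] by simp
    ultimately have "AE \<omega> in M. cond_prob_given M W ?A \<omega> =
        cond_prob_given M W ?A \<omega> * cond_prob_given M W ?A \<omega>"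
      by eventually_elim simp
    then show "determined_by M W ?A"
      by (intro determined_by_if_cond_prob_idempotent W) auto
  qed
next
  assume "\<exists>f\<in>borel_measurable borel. AE \<omega> in M. Z \<omega> = f (W \<omega>)"
  then obtain f where f: "f \<in> borel_measurable borel" "AE \<omega> in M. Z \<omega> = f (W \<omega>)" by blast
  note cut = cond_iid_copy_not_separated[OF W Z Z' iid f]
  show "AE \<omega> in M. Z \<omega> = Z' \<omega>"
  proof (rule AE_eq_if_rational_cuts)
    fix r :: real
    show "AE \<omega> in M. \<not> (Z \<omega> \<le> r \<and> r < Z' \<omega>)"
      using cut[of "{..r}"] by (simp add: not_le)
    show "AE \<omega> in M. \<not> (Z' \<omega> \<le> r \<and> r < Z \<omega>)"
      using cut[of "{r<..}"] by (auto simp: not_less elim!: eventually_mono)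
  qed
qed

section \<open>Perfect dependence\<close>

theorem theorem2p3:
  fixes M :: "'a measure" and N :: "'b measure" and p :: "'b \<Rightarrow> 'a"
    and Y :: "'a \<Rightarrow> real" and X :: "'a \<Rightarrow> real ^ 'd" and Y' :: "'b \<Rightarrow> real"
  assumes "prob_space M"
    and "Y \<in> borel_measurable M" and "X \<in> borel_measurable M"
    and "continuous_on UNIV (distribution_function M Y)"
    and "prob_space_extension M N p"
    and "Y' \<in> borel_measurable N"
    and "cond_iid_given N (X \<circ> p) (Y \<circ> p) Y'"
  shows "phi N (Y \<circ> p) Y' 0 = 1 \<longleftrightarrow>
    (\<exists>f :: real ^ 'd \<Rightarrow> real. f \<in> borel_measurable borel \<and> (AE \<omega> in M. Y \<omega> = f (X \<omega>)))"
proof -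
  have p: "p \<in> measurable N M" and distr_p: "distr N M p = M" and N: "prob_space N"
    using assms(5) by (auto simp: prob_space_extension_def)
  interpret N: prob_space N by (rule N)
  have YN: "Y \<circ> p \<in> borel_measurable N" and XN: "X \<circ> p \<in> borel_measurable N"
    using measurable_comp[OF p] assms(2,3) by auto
  \<comment> \<open>Almost sure statements about \<open>X\<close> and \<open>Y\<close> do not depend on the space they are realised on.\<close>
  have transfer: "(AE \<omega> in N. (Y \<circ> p) \<omega> = f ((X \<circ> p) \<omega>)) \<longleftrightarrow> (AE \<omega> in M. Y \<omega> = f (X \<omega>))"
    if [measurable]: "f \<in> borel_measurable borel" for f :: "real ^ 'd \<Rightarrow> real"
  proof -
    note [measurable] = assms(2,3)
    have "{\<omega> \<in> space M. Y \<omega> = f (X \<omega>)} \<in> sets M" by measurable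
    from AE_distr_iff[OF p this] show ?thesis
      unfolding distr_p comp_apply by (rule sym)
  qed
  have "phi N (Y \<circ> p) Y' 0 = 1 \<longleftrightarrow> (AE \<omega> in N. (Y \<circ> p) \<omega> = Y' \<omega>)"
    using YN assms(6) N.cond_iid_given_same_law[OF XN YN assms(6,7)] by (rule N.phi_0_eq_1_iff)
  also have "\<dots> \<longleftrightarrow> (\<exists>f\<in>borel_measurable borel. AE \<omega> in N. (Y \<circ> p) \<omega> = f ((X \<circ> p) \<omega>))"
    by (rule N.AE_eq_cond_iid_copy_iff[OF XN YN assms(6,7)])
  also have "\<dots> \<longleftrightarrow> (\<exists>f. f \<in> borel_measurable borel \<and> (AE \<omega> in M. Y \<omega> = f (X \<omega>)))"
    using transfer by blast
  finally show ?thesis .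
qed

end
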